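(* Consider the Godunov-type multi-path scheme on a merge (two incoming roads, one outgoing road, two paths), as described in the context, with cell $J$ being the first cell after the junction. Let the initial densities around the junction be admissible, namely $$\mu_{J-1}^{0,1}\leq\rho_{\max},\qquad \mu_{J-1}^{0,2}\leq\rho_{\max},\qquad \mu_{J}^{0,1}+\mu_{J}^{0,2}\leq\rho_{\max},\qquad \mu_{J+1}^{0,1}+\mu_{J+1}^{0,2}\leq\rho_{\max}.$$ If $$2\,\frac{\Delta t}{\Delta x}\,\sup_{\rho\in(0,\rho_{\max})}|f'(\rho)|\leq 1,$$ then $$\mu_{J}^{n,1}+\mu_{J}^{n,2}\leq\rho_{\max}\qquad\text{for all } n\ge 0.$$
   Context: Flux. Let $\rho_{\max}>0$ and let $f\in C^0([0,\rho_{\max}])\cap C^1((0,\rho_{\max}))$ be strictly concave with $f(0)=f(\rho_{\max})=0$; let $\sigma:=\arg\max_{(0,\rho_{\max})}f$. The Godunov numerical flux is $$G(\rho_\ell,\rho_r):=\begin{cases}\min\{f(\rho_\ell),f(\rho_r)\} & \text{if }\rho_\ell\le\rho_r,\\ f(\rho_\ell) & \text{if }\rho_\ell>\rho_r\text{ and }\rho_\ell<\sigma,\\ f(\sigma) & \text{if }\rho_\ell>\rho_r\text{ and }\rho_\ell\ge\sigma\ge\rho_r,\\ f(\rho_r) & \text{if }\rho_\ell>\rho_r\text{ and }\rho_r>\sigma.\end{cases}$$ Network. Two incoming roads merge into one outgoing road. Path $p\in\{1,2\}$ consists of the $p$-th incoming road followed by the outgoing road. The cells along path $p$ are indexed by consecutive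 integers $k$, so that the cells with $k<J$ along path $1$ and along path $2$ are distinct (they belong to the respective incoming roads), while the cells with $k\ge J$ are common to both paths (outgoing road). $\Delta x>0$ and $\Delta t>0$ are the space and time steps, and $\mu_k^{n,p}$ is the approximate density at cell $k$ of path $p$ and time step $n$ of the vehicles following path $p$. Total density. For $p=1,2$, along path $p$, $$\omega_{k^p}^n=\begin{cases}\mu_k^{n,p} & k<J,\\ \mu_k^{n,1}+\mu_k^{n,2} & k\ge J,\end{cases}$$ where $k^p$ denotes the $k$-th cell along path $p$. Scheme. At every internal cell $k$ of path $p$ (the cells $J-1,J,J+1$ being internal), for $p=1,2$ and $n\ge0$, $$\mu_{k}^{n+1,p}=\mu_{k}^{n,p}-\frac{\Delta t}{\Delta x}\left(\frac{\mu_{k}^{n,p}}{\omega_{k^p}^n}G(\omega_{k^p}^n,\omega_{(k+1)^p}^n)-\frac{\mu_{k-1}^{n,p}}{\omega_{(k-1)^p}^n}G(\omega_{(k-1)^p}^n,\omega_{k^p}^n)\right),$$ with the convention that the ratio $\mu/\omega$ is $0$ when $\omega=0$. At the first and last cell of each path, boundary values are prescribed at every time step. Standing assumption. All initial data and boundary values are nonnegative and admissible, i.e. at each cell all densities $\mu^p$ are $\ge0$ and the total density $\omega$ is $\le\rho_{\max}$. *)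

theory Defs
  imports "HOL-Analysis.Analysis"
begin

definition strictly_concave_on :: "'a::real_vector set \<Rightarrow> ('a \<Rightarrow> real) \<Rightarrow> bool" where
  "strictly_concave_on S f \<longleftrightarrow> convex S \<and>
     (\<forall>x\<in>S. \<forall>y\<in>S. \<forall>t. x \<noteq> y \<and> 0 < t \<and> t < 1 \<longrightarrow>
        (1 - t) * f x + t * f y < f ((1 - t) *\<^sub>R x + t *\<^sub>R y))"

(* Only the values of f on the closed interval [0, \<rho>max] are meaningful. *)
definition concave_flux :: "real \<Rightarrow> (real \<Rightarrow> real) \<Rightarrow> bool" where
  "concave_flux \<rho>max f \<longleftrightarrow>
     continuous_on {0..\<rho>max} f \<and> f C1_differentiable_on {0<..<\<rho>max} \<and>
     strictly_concave_on {0..\<rho>max} f \<and> f 0 = 0 \<and> f \<rho>max = 0"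

definition godunov_flux :: "real \<Rightarrow> (real \<Rightarrow> real) \<Rightarrow> real \<Rightarrow> real \<Rightarrow> real" where
  "godunov_flux \<rho>max f \<rho>l \<rho>r =
     (let \<sigma> = arg_max_on f {0<..<\<rho>max} in
      if \<rho>l \<le> \<rho>r then min (f \<rho>l) (f \<rho>r)
      else if \<rho>l < \<sigma> then f \<rho>l
      else if \<sigma> \<ge> \<rho>r then f \<sigma>
      else f \<rho>r)"

(* A grid function \<mu> is read as \<mu> n p k: time step n, path p \<in> {1, 2}, cell k of path p.
   Cells k < J belong to the p-th incoming road, cells k \<ge> J to the common outgoing road. *)
definition total_density :: "int \<Rightarrow> (nat \<Rightarrow> nat \<Rightarrow> int \<Rightarrow> real) \<Rightarrow> nat \<Rightarrow> nat \<Rightarrow> int \<Rightarrow> real" where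
  "total_density J \<mu> n p k = (if k < J then \<mu> n p k else \<mu> n 1 k + \<mu> n 2 k)"

(* Path p consists of the cells a p, ..., b; the last cell b lies on the outgoing road and is
   therefore common to both paths.  The update is imposed at internal cells only, so the values
   at the cells a p and b are free boundary data at every time step.
   The convention \<mu> / \<omega> = 0 for \<omega> = 0 is that of division in HOL. *)
definition multipath_merge_scheme ::
  "real \<Rightarrow> (real \<Rightarrow> real) \<Rightarrow> real \<Rightarrow> real \<Rightarrow> int \<Rightarrow> (nat \<Rightarrow> int) \<Rightarrow> int \<Rightarrow>
   (nat \<Rightarrow> nat \<Rightarrow> int \<Rightarrow> real) \<Rightarrow> bool" where
  "multipath_merge_scheme \<rho>max f \<Delta>t \<Delta>x J a b \<mu> \<longleftrightarrow>
     (let \<omega> = total_density J \<mu>; G = godunov_flux \<rho>max f in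
      \<forall>n. \<forall>p\<in>{1, 2}. \<forall>k. a p < k \<and> k < b \<longrightarrow>
        \<mu> (Suc n) p k = \<mu> n p k - \<Delta>t / \<Delta>x *
          (\<mu> n p k / \<omega> n p k * G (\<omega> n p k) (\<omega> n p (k + 1))
           - \<mu> n p (k - 1) / \<omega> n p (k - 1) * G (\<omega> n p (k - 1)) (\<omega> n p k)))"

definition admissible_at ::
  "real \<Rightarrow> int \<Rightarrow> (nat \<Rightarrow> nat \<Rightarrow> int \<Rightarrow> real) \<Rightarrow> nat \<Rightarrow> nat \<Rightarrow> int \<Rightarrow> bool" where
  "admissible_at \<rho>max J \<mu> n p k \<longleftrightarrow> 0 \<le> \<mu> n p k \<and> total_density J \<mu> n p k \<le> \<rho>max"

end

theory Submission
  imports Defs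
begin

text \<open>
  Put \<open>L = \<Delta>x / (2 \<Delta>t)\<close>. By the CFL condition \<open>f\<close> is \<open>L\<close>-Lipschitz, and since it vanishes at both
  ends, \<open>0 \<le> G(u, v) \<le> L min(u, \<rho>max - v)\<close>. The first bound limits the outflow of each class by its
  own mass, which gives nonnegativity. The second one limits the inflow from each incoming road by
  \<open>L\<close> times the free space of the receiving cell; there are at most two such inflows, so with
  \<open>2 L \<Delta>t / \<Delta>x = 1\<close> the free space stays nonnegative. Both properties are propagated together, over
  all cells, by induction on time.
\<close>

text \<open>The chord joining the endpoints is identically zero, and strict concavity keeps the
  graph above it.\<close>

lemma strictly_concave_on_pos:
  fixes f :: "real \<Rightarrow> real"
  assumes "strictly_concave_on {a..b} f" "f a = 0" "f b = 0" "a < x" "x < b"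
  shows "0 < f x"
proof -
  define t where "t = (x - a) / (b - a)"
  have t: "0 < t" "t < 1" and "t * (b - a) = x - a"
    using assms(4,5) unfolding t_def by simp_all
  then have x: "(1 - t) *\<^sub>R a + t *\<^sub>R b = x"
    by (simp add: algebra_simps)
  have "(1 - t) * f a + t * f b < f ((1 - t) *\<^sub>R a + t *\<^sub>R b)"
    using assms(1,4,5) t unfolding strictly_concave_on_def by simp
  then show ?thesis
    using assms(2,3) x by simp
qed

lemma concave_flux_nonneg:
  assumes "concave_flux \<rho>max f" "u \<in> {0..\<rho>max}"
  shows "0 \<le> f u"
proof (cases "u = 0 \<or> u = \<rho>max")
  case True
  then show ?thesis using assms(1) unfolding concave_flux_def by auto
next
  case False
  then show ?thesis
    using assms strictly_concave_on_pos[of 0 \<rho>max f u] unfolding concave_flux_def by force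
qed

text \<open>\<open>arg_max_on\<close> is a choice operator, so its value means something only once a
  maximizer exists in the open interval. Compactness gives one on the closed interval, and
  positivity at the midpoint excludes both ends.\<close>

lemma concave_flux_arg_max:
  assumes flux: "concave_flux \<rho>max f" and pos: "0 < \<rho>max"
  shows "arg_max_on f {0<..<\<rho>max} \<in> {0<..<\<rho>max}"
proof -
  have "continuous_on {0..\<rho>max} f" and f0: "f 0 = 0" "f \<rho>max = 0"
    and conc: "strictly_concave_on {0..\<rho>max} f"
    using flux by (auto simp: concave_flux_def)
  then obtain s where s: "s \<in> {0..\<rho>max}" "\<And>y. y \<in> {0..\<rho>max} \<Longrightarrow> f y \<le> f s"
    using continuous_attains_sup[of "{0..\<rho>max}" f] pos by auto
  have "0 < f (\<rho>max / 2)"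
    using strictly_concave_on_pos[OF conc f0] pos by simp
  also have "\<dots> \<le> f s"
    using s(2) pos by simp
  finally have "s \<noteq> 0" "s \<noteq> \<rho>max"
    using f0 by auto
  then have "s \<in> {0<..<\<rho>max}"
    using s(1) by auto
  moreover have "\<not> f s < f y" if "y \<in> {0<..<\<rho>max}" for y
    using s(2)[of y] that by simp
  ultimately have "is_arg_max f (\<lambda>x. x \<in> {0<..<\<rho>max}) s"
    unfolding is_arg_max_def by blast
  then show ?thesis
    unfolding arg_max_on_def arg_max_def
    by (rule someI2[where P = "is_arg_max f (\<lambda>x. x \<in> {0<..<\<rho>max})"]) (simp add: is_arg_max_def)
qed

text \<open>Mean value theorem between \<open>u\<close> and each of the two zeros of
  \<open>f\<close>.\<close>

lemma concave_flux_le: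
  assumes flux: "concave_flux \<rho>max f"
    and L: "\<forall>x\<in>{0<..<\<rho>max}. \<bar>deriv f x\<bar> \<le> L"
    and u: "u \<in> {0..\<rho>max}"
  shows "f u \<le> L * u" "f u \<le> L * (\<rho>max - u)"
proof -
  have f0: "f 0 = 0" "f \<rho>max = 0" and cont: "continuous_on {0..\<rho>max} f"
    and C1: "f C1_differentiable_on {0<..<\<rho>max}"
    using flux by (auto simp: concave_flux_def)
  have der: "(f has_real_derivative deriv f x) (at x)" if "x \<in> {0<..<\<rho>max}" for x
  proof -
    have "(f has_real_derivative vector_derivative f (at x)) (at x)"
      using C1_differentiable_on_eq[THEN iffD1, OF C1] that
      by (simp add: vector_derivative_works has_real_derivative_iff_has_vector_derivative)
    then show ?thesis
      using DERIV_imp_deriv by metis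
  qed
  \<comment> \<open>The endpoints of the domain are allowed: the mean value theorem asks only for
    continuity there, and its intermediate point is interior.\<close>
  have lip: "\<bar>f y - f x\<bar> \<le> L * (y - x)" if "0 \<le> x" "x < y" "y \<le> \<rho>max" for x y
  proof -
    have "continuous_on {x..y} f"
      by (rule continuous_on_subset[OF cont]) (use that in auto)
    moreover have "f differentiable (at z)" if "x < z" "z < y" for z
      using der[of z] that \<open>0 \<le> x\<close> \<open>y \<le> \<rho>max\<close>
      by (auto simp: real_differentiable_def)
    ultimately obtain l z where z: "x < z" "z < y" "DERIV f z :> l" "f y - f x = (y - x) * l"
      using MVT[OF \<open>x < y\<close>, of f] by auto
    have "\<bar>l\<bar> \<le> L"
      using L z that DERIV_imp_deriv[OF z(3)] by auto
    then show ?thesis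
      using z(4) \<open>x < y\<close> by (simp add: abs_mult mult.commute mult_right_mono)
  qed
  show "f u \<le> L * u"
    using lip[of 0 u] f0 u by (cases "u = 0") auto
  show "f u \<le> L * (\<rho>max - u)"
    using lip[of u \<rho>max] f0 u by (cases "u = \<rho>max") auto
qed

text \<open>If \<open>u \<le> v\<close>, the minimum is below both \<open>f u\<close> and
  \<open>f v\<close>. Otherwise every branch returns \<open>f s\<close> with
  \<open>v \<le> s \<le> u\<close>, so \<open>f s \<le> L * s \<le> L * u\<close> and
  \<open>f s \<le> L * (\<rho>max - s) \<le> L * (\<rho>max - v)\<close>.\<close>

lemma godunov_flux_bounds:
  assumes flux: "concave_flux \<rho>max f" and pos: "0 < \<rho>max"
    and L: "\<forall>x\<in>{0<..<\<rho>max}. \<bar>deriv f x\<bar> \<le> L"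
    and u: "u \<in> {0..\<rho>max}" and v: "v \<in> {0..\<rho>max}"
  shows "0 \<le> godunov_flux \<rho>max f u v"
    and "godunov_flux \<rho>max f u v \<le> L * u"
    and "godunov_flux \<rho>max f u v \<le> L * (\<rho>max - v)"
proof -
  define \<sigma> where "\<sigma> = arg_max_on f {0<..<\<rho>max}"
  have \<sigma>: "\<sigma> \<in> {0..\<rho>max}"
    using concave_flux_arg_max[OF flux pos] by (simp add: \<sigma>_def)
  have "0 \<le> L"
    using bspec[OF L, of "\<rho>max / 2"] pos by auto
  then have mono: "L * x \<le> L * y" if "x \<le> y" for x y
    using that by (rule mult_left_mono[rotated])
  note defs = godunov_flux_def Let_def \<sigma>_def[symmetric]
  note le = concave_flux_le[OF flux L]
  show "0 \<le> godunov_flux \<rho>max f u v"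
    using concave_flux_nonneg[OF flux] u v \<sigma> by (simp add: defs)
  show "godunov_flux \<rho>max f u v \<le> L * u"
    using le(1)[OF u] le(1)[OF v] le(1)[OF \<sigma>] mono[of v u] mono[of \<sigma> u]
    unfolding defs by (auto simp del: mult_le_cancel_left)
  show "godunov_flux \<rho>max f u v \<le> L * (\<rho>max - v)"
    using le(2)[OF u] le(2)[OF v] le(2)[OF \<sigma>]
      mono[of "\<rho>max - u" "\<rho>max - v"] mono[of "\<rho>max - \<sigma>" "\<rho>max - v"]
    unfolding defs by (auto simp del: mult_le_cancel_left)
qed

text \<open>Here \<open>m\<close> is the mass of one class in a cell of total density
  \<open>w\<close>, and \<open>m / w * g\<close> its share of the flux \<open>g\<close>. In an empty
  cell the share is 0 by the division convention, and \<open>m = 0\<close>.\<close>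

lemma proportional_share_bounds:
  fixes m w g :: real
  assumes "0 \<le> m" "m \<le> w" "0 \<le> g" "g \<le> L * w"
  shows "0 \<le> m / w * g" "m / w * g \<le> L * m" "m / w * g \<le> g"
proof -
  show "0 \<le> m / w * g"
    using assms by simp
  have "m / w * g \<le> m / w * (L * w)"
    using assms by (intro mult_left_mono) auto
  also have "\<dots> \<le> L * m"
    using assms by (cases "w = 0") auto
  finally show "m / w * g \<le> L * m" .
  have "m / w \<le> 1"
    using assms by (cases "w = 0") auto
  then show "m / w * g \<le> g"
    using assms(3) mult_right_mono[of "m / w" 1 g] by simp
qed

text \<open>The supremum is taken in \<open>ereal\<close>, so an unbounded derivative gives infinity
  and violates the CFL condition.\<close>

lemma deriv_le_of_CFL:
  fixes c :: real
  assumes "0 < c" "2 * ereal c * (SUP x\<in>S. ereal \<bar>deriv f x\<bar>) \<le> 1"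
  shows "\<forall>x\<in>S. \<bar>deriv f x\<bar> \<le> 1 / (2 * c)"
proof
  fix x
  assume "x \<in> S"
  have "2 * ereal c * ereal \<bar>deriv f x\<bar> \<le> 2 * ereal c * (SUP x\<in>S. ereal \<bar>deriv f x\<bar>)"
    using \<open>x \<in> S\<close> assms(1) by (intro ereal_mult_left_mono SUP_upper) auto
  also have "\<dots> \<le> 1"
    by (fact assms(2))
  finally have "ereal (2 * c * \<bar>deriv f x\<bar>) \<le> ereal 1"
    by (simp flip: times_ereal.simps(1) add: one_ereal_def)
  then show "\<bar>deriv f x\<bar> \<le> 1 / (2 * c)"
    using assms(1) by (simp add: field_simps)
qed

text \<open>A bound at cell \<open>J\<close> alone does not reproduce itself, since the update there
  involves the cells \<open>J - 1\<close> and \<open>J + 1\<close>; hence the induction hypothesis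
  covers every cell of both paths.\<close>

lemma merge_scheme_admissible:
  assumes pos: "\<rho>max > 0" and flux: "concave_flux \<rho>max f" and c: "\<Delta>t / \<Delta>x > 0"
    and L: "\<forall>x\<in>{0<..<\<rho>max}. \<bar>deriv f x\<bar> \<le> 1 / (2 * (\<Delta>t / \<Delta>x))"
    and a: "\<And>p. p \<in> {1, 2} \<Longrightarrow> a p < J - 1"
    and scheme: "multipath_merge_scheme \<rho>max f \<Delta>t \<Delta>x J a b \<mu>"
    and initial: "\<And>p k. p \<in> {1, 2} \<Longrightarrow> k \<in> {a p..b} \<Longrightarrow> admissible_at \<rho>max J \<mu> 0 p k"
    and boundary: "\<And>n p k. p \<in> {1, 2} \<Longrightarrow> k \<in> {a p, b} \<Longrightarrow> admissible_at \<rho>max J \<mu> n p k"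
    and pk: "p \<in> {1, 2}" "k \<in> {a p..b}"
  shows "admissible_at \<rho>max J \<mu> n p k"
  using pk
proof (induction n arbitrary: p k)
  case 0
  then show ?case by (rule initial)
next
  case (Suc n)
  define c where "c = \<Delta>t / \<Delta>x"
  define L where "L = 1 / (2 * c)"
  have c: "c > 0" and cL: "c * L = 1 / 2"
    using c by (auto simp: c_def L_def)
  define \<omega> where "\<omega> = total_density J \<mu> n"
  \<comment> \<open>Interfaces are indexed by the cell on their left: \<open>F p k\<close> is what
    class \<open>p\<close> sends out of cell \<open>k\<close>, and \<open>F p (k - 1)\<close> what
    it brings in.\<close>
  define G where "G p k = godunov_flux \<rho>max f (\<omega> p k) (\<omega> p (k + 1))" for p k
  define F where "F p k = \<mu> n p k / \<omega> p k * G p k" for p k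
  have upd: "\<mu> (Suc n) p k = \<mu> n p k - c * (F p k - F p (k - 1))"
    if "p \<in> {1, 2}" "a p < k" "k < b" for p k
    using scheme that
    unfolding multipath_merge_scheme_def Let_def F_def G_def \<omega>_def c_def diff_add_cancel
    by blast
  have m0: "0 \<le> \<mu> n p k" and wmax: "\<omega> p k \<le> \<rho>max" if "p \<in> {1, 2}" "k \<in> {a p..b}" for p k
    using Suc.IH[OF that] by (auto simp: admissible_at_def \<omega>_def)
  \<comment> \<open>An outgoing cell lies on both paths, so nonnegativity is available for both
    classes there; this gives \<open>mw\<close>.\<close>
  have out: "k \<in> {a p..b}" if "p \<in> {1, 2}" "J \<le> k" "k \<le> b" for p k
    using a[OF that(1)] that by auto
  have mw: "\<mu> n p k \<le> \<omega> p k" if "p \<in> {1, 2}" "k \<in> {a p..b}" for p k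
    using that m0[of 1 k] m0[of 2 k] out[of 1 k] out[of 2 k]
    by (auto simp: \<omega>_def total_density_def)
  have wI: "\<omega> p k \<in> {0..\<rho>max}" if "p \<in> {1, 2}" "k \<in> {a p..b}" for p k
    using m0[OF that] mw[OF that] wmax[OF that] by auto
  have G: "0 \<le> G p k" "G p k \<le> L * \<omega> p k" "G p k \<le> L * (\<rho>max - \<omega> p (k + 1))"
    if "p \<in> {1, 2}" "a p \<le> k" "k < b" for p k
    using godunov_flux_bounds[OF flux pos L wI wI, of p k p "k + 1"] that
    by (auto simp: G_def L_def c_def)
  have F: "0 \<le> F p k" "F p k \<le> L * \<mu> n p k" "F p k \<le> L * (\<rho>max - \<omega> p (k + 1))"
    if "p \<in> {1, 2}" "a p \<le> k" "k < b" for p k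
    using proportional_share_bounds[OF m0 mw G(1,2), of p k] G(3)[of p k] that
    unfolding F_def by auto
  \<comment> \<open>Since \<open>c * L = 1 / 2\<close>, one time step moves at most half of the
    class mass and fills at most half of the free space of the next cell.\<close>
  have cF: "c * F p k \<le> \<mu> n p k / 2" "c * F p k \<le> (\<rho>max - \<omega> p (k + 1)) / 2"
    if "p \<in> {1, 2}" "a p \<le> k" "k < b" for p k
  proof -
    have half: "c * (L * y) = y / 2" for y
      using cL by (metis mult.assoc times_divide_eq_left mult_1)
    show "c * F p k \<le> \<mu> n p k / 2" "c * F p k \<le> (\<rho>max - \<omega> p (k + 1)) / 2"
      using F(2,3)[OF that] c half by (metis mult_left_mono less_imp_le)+
  qed
  have cF0: "0 \<le> c * F p k" if "p \<in> {1, 2}" "a p \<le> k" "k < b" for p k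
    using F(1)[OF that] c by simp
  have upd': "\<mu> (Suc n) p k = \<mu> n p k - c * F p k + c * F p (k - 1)"
    if "p \<in> {1, 2}" "a p < k" "k < b" for p k
    using upd[OF that] by (simp add: algebra_simps)
  show ?case
  proof (cases "k = a p \<or> k = b")
    case True
    then show ?thesis using boundary Suc.prems by blast
  next
    case False
    with Suc.prems have k: "a p < k" "k < b" and p: "p \<in> {1, 2}" by auto
    have "0 \<le> \<mu> (Suc n) p k"
      using upd'[OF p k] cF(1)[OF p, of k] cF0[OF p, of "k - 1"] m0[OF p, of k] k by auto
    moreover have "total_density J \<mu> (Suc n) p k \<le> \<rho>max"
    proof (cases "k < J")
      \<comment> \<open>On an incoming road only one class enters, filling at most half of the free
        space.\<close>
      case True
      have "\<mu> n p k = \<omega> p k"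
        using True by (simp add: \<omega>_def total_density_def)
      then show ?thesis
        using upd'[OF p k] cF0[OF p, of k] cF(2)[OF p, of "k - 1"] wmax[OF p, of k] k True
        by (auto simp: total_density_def)
    next
      case False
      have P: "1 \<in> {1, 2::nat}" "2 \<in> {1, 2::nat}" by auto
      have ak: "a 1 < k" "a 2 < k"
        using a[OF P(1)] a[OF P(2)] False by auto
      have w: "\<omega> q k = \<mu> n 1 k + \<mu> n 2 k" for q
        using False by (simp add: \<omega>_def total_density_def)
      have room: "\<mu> n 1 k + \<mu> n 2 k \<le> \<rho>max"
        using wmax[OF p, of k] k w by auto
      \<comment> \<open>The factor 2 in the CFL condition is spent here: at \<open>k = J\<close> the
        inflows come from two different cells, and each may claim half of the free space.\<close>
      have "c * F 1 (k - 1) + c * F 2 (k - 1) \<le> \<rho>max - (\<mu> n 1 k + \<mu> n 2 k)"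
        using cF(2)[OF P(1), of "k - 1"] cF(2)[OF P(2), of "k - 1"] ak k w by auto
      then have "\<mu> (Suc n) 1 k + \<mu> (Suc n) 2 k \<le> \<rho>max"
        using upd'[OF P(1) ak(1) k(2)] upd'[OF P(2) ak(2) k(2)]
          cF0[OF P(1), of k] cF0[OF P(2), of k] ak k by auto
      then show ?thesis
        using False by (simp add: total_density_def)
    qed
    ultimately show ?thesis by (simp add: admissible_at_def)
  qed
qed

theorem theorem3p1:
  fixes \<rho>max \<Delta>t \<Delta>x :: real
    and f :: "real \<Rightarrow> real"
    and J b :: int and a :: "nat \<Rightarrow> int"
    and \<mu> :: "nat \<Rightarrow> nat \<Rightarrow> int \<Rightarrow> real"
  assumes "\<rho>max > 0" and "concave_flux \<rho>max f"
    and "\<Delta>t > 0" and "\<Delta>x > 0"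
    and internal: "\<And>p. p \<in> {1, 2} \<Longrightarrow> a p < J - 1" "J + 1 < b"
    and scheme: "multipath_merge_scheme \<rho>max f \<Delta>t \<Delta>x J a b \<mu>"
    and initial: "\<And>p k. p \<in> {1, 2} \<Longrightarrow> k \<in> {a p..b} \<Longrightarrow> admissible_at \<rho>max J \<mu> 0 p k"
    and boundary: "\<And>n p k. p \<in> {1, 2} \<Longrightarrow> k \<in> {a p, b} \<Longrightarrow> admissible_at \<rho>max J \<mu> n p k"
    and junction: "\<mu> 0 1 (J - 1) \<le> \<rho>max" "\<mu> 0 2 (J - 1) \<le> \<rho>max"
      "\<mu> 0 1 J + \<mu> 0 2 J \<le> \<rho>max" "\<mu> 0 1 (J + 1) + \<mu> 0 2 (J + 1) \<le> \<rho>max"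
    and CFL: "2 * ereal (\<Delta>t / \<Delta>x) * (SUP \<rho>\<in>{0<..<\<rho>max}. ereal \<bar>deriv f \<rho>\<bar>) \<le> 1"
  shows "\<forall>n. \<mu> n 1 J + \<mu> n 2 J \<le> \<rho>max"
proof
  fix n
  have c: "\<Delta>t / \<Delta>x > 0"
    using \<open>\<Delta>t > 0\<close> \<open>\<Delta>x > 0\<close> by simp
  have "J \<in> {a 1..b}"
    using internal(1)[of 1] internal(2) by auto
  \<comment> \<open>At \<open>J\<close> the total density along path 1 already sums both
    classes.\<close>
  then have "admissible_at \<rho>max J \<mu> n 1 J"
    using merge_scheme_admissible[OF assms(1,2) c deriv_le_of_CFL[OF c CFL] internal(1) scheme
        initial boundary]
    by simp
  then show "\<mu> n 1 J + \<mu> n 2 J \<le> \<rho>max"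
    by (simp add: admissible_at_def total_density_def)
qed

end
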